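(* Let $D$ be a one-way split digraph of order $n$ with no sinks. Then $D$ has a quasi-kernel of size at most $\frac{n+3}{2}-\sqrt{n}$. Furthermore, for infinitely many values of $n$ there exists a one-way split digraph of order $n$ with no sink such that the minimum size of its quasi-kernels is exactly $\frac{n+3}{2}-\sqrt{n}$.
   Context: A one-way split digraph is a digraph $D$ whose vertex set can be partitioned into sets $X$ and $Y$ such that $X$ is independent, $D[Y]$ is semicomplete (at least one arc between every pair of distinct vertices of $Y$), and every arc between $X$ and $Y$ goes from $X$ to $Y$. A sink is a vertex with no out-neighbour. A quasi-kernel of $D$ is an independent set $Q\subseteq V(D)$ such that for every vertex $v\in V(D)\setminus Q$ there is a directed path with one or two arcs from $v$ to some vertex of $Q$. *)

theory Defs
  imports Complex_Main "Graph_Theory.Digraph_Component"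
begin

definition independent_set :: "('a, 'b) pre_digraph \<Rightarrow> 'a set \<Rightarrow> bool" where
  "independent_set D S \<longleftrightarrow> S \<subseteq> verts D \<and> (\<forall>u\<in>S. \<forall>v\<in>S. \<not> u \<rightarrow>\<^bsub>D\<^esub> v)"

definition semicomplete :: "('a, 'b) pre_digraph \<Rightarrow> bool" where
  "semicomplete D \<longleftrightarrow>
     (\<forall>u\<in>verts D. \<forall>v\<in>verts D. u \<noteq> v \<longrightarrow> u \<rightarrow>\<^bsub>D\<^esub> v \<or> v \<rightarrow>\<^bsub>D\<^esub> u)"

(* Either part of the partition may be empty.  Since X and Y partition the vertex set,
   "every arc between X and Y goes from X to Y" says that no arc goes from Y to X. *)
definition one_way_split :: "('a, 'b) pre_digraph \<Rightarrow> bool" where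
  "one_way_split D \<longleftrightarrow>
     (\<exists>X Y. verts D = X \<union> Y \<and> X \<inter> Y = {} \<and>
        independent_set D X \<and>
        semicomplete (D \<restriction> Y) \<and>
        (\<forall>x\<in>X. \<forall>y\<in>Y. \<not> y \<rightarrow>\<^bsub>D\<^esub> x))"

definition sink :: "('a, 'b) pre_digraph \<Rightarrow> 'a \<Rightarrow> bool" where
  "sink D v \<longleftrightarrow> v \<in> verts D \<and> \<not> (\<exists>w\<in>verts D. v \<rightarrow>\<^bsub>D\<^esub> w)"

definition quasi_kernel :: "('a, 'b) pre_digraph \<Rightarrow> 'a set \<Rightarrow> bool" where
  "quasi_kernel D Q \<longleftrightarrow>
     independent_set D Q \<and>
     (\<forall>v\<in>verts D - Q. \<exists>q\<in>Q. \<exists>p. pre_digraph.apath D v p q \<and> length p \<in> {1, 2})"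

end

(*
A quasi-kernel contains at most one vertex y of the semicomplete part Y, and all arcs between X and Y
leave X, so the small quasi-kernels consist of a vertex y of Y that every vertex of Y reaches in at most
two steps, together with the vertices of X that do not reach y in at most two steps.  Choose an
out-neighbour in Y for every vertex of X and let w(z) count the vertices of X that chose z.  Among the
y minimising the total weight of the vertices of Y that have no arc to y, one with the fewest such
vertices is reached by all of Y in at most two steps; averaging over y with weights w and using
Cauchy-Schwarz, this minimal weight is at most (W - W/m)/2, where m = |Y| and W = |X| = n - m.
Since m + n/m >= 2 sqrt n, the bound follows.  Equality holds for n = m^2 when Y is the rotational
tournament on m = 2k+1 vertices and every vertex of Y receives arcs from m - 1 private vertices of X.
*)
theory Submission
  imports Defs "HOL-Analysis.Convex"
begin

section \<open>Kings and non-neighbour weights in semicomplete relations\<close>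

text \<open>If \<open>z\<close> fails to reach \<open>y\<close> in two steps, then totality gives an
  arc from \<open>z\<close> to every \<open>u\<close> in \<open>N Y z\<close>, so such a
  \<open>u\<close> is neither \<open>y\<close> nor has an arc to \<open>y\<close>. Hence
  \<open>N Y z\<close> lies in \<open>N Y y\<close>, strictly because \<open>z\<close> itself is in
  the latter only, and \<open>z\<close> would have been a better choice than
  \<open>y\<close>.\<close>

lemma king_of_minimal_nonneighbour_weight:
  fixes R :: "'a \<Rightarrow> 'a \<Rightarrow> bool" and w :: "'a \<Rightarrow> nat"
  defines "N \<equiv> \<lambda>Y y. {z \<in> Y. z \<noteq> y \<and> \<not> R z y}"
  assumes fin: "finite Y" and ne: "Y \<noteq> {}"
    and total: "\<And>u v. u \<in> Y \<Longrightarrow> v \<in> Y \<Longrightarrow> u \<noteq> v \<Longrightarrow> R u v \<or> R v u"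
  obtains y where "y \<in> Y" and "\<And>z. z \<in> Y \<Longrightarrow> z = y \<or> R z y \<or> (\<exists>u\<in>Y. R z u \<and> R u y)"
    and "\<And>z. z \<in> Y \<Longrightarrow> sum w (N Y y) \<le> sum w (N Y z)"
proof -
  obtain a where a: "a \<in> Y" "\<And>z. z \<in> Y \<Longrightarrow> sum w (N Y a) \<le> sum w (N Y z)"
    using ex_has_least_nat[of "\<lambda>y. y \<in> Y" _ "\<lambda>y. sum w (N Y y)"] ne by blast
  \<comment> \<open>Weights may be zero, so a strictly smaller set need not weigh less; cardinality
    breaks the ties.\<close>
  obtain y where y: "y \<in> Y" "sum w (N Y y) \<le> sum w (N Y a)"
    "\<And>z. z \<in> Y \<Longrightarrow> sum w (N Y z) \<le> sum w (N Y a) \<Longrightarrow> card (N Y y) \<le> card (N Y z)"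
    using ex_has_least_nat[of "\<lambda>y. y \<in> Y \<and> sum w (N Y y) \<le> sum w (N Y a)" a "\<lambda>y. card (N Y y)"]
      a(1) by blast
  have finN: "finite (N Y z)" for z
    using fin by (simp add: N_def)
  show thesis
  proof
    show "y \<in> Y" by fact
    show "sum w (N Y y) \<le> sum w (N Y z)" if "z \<in> Y" for z
      using y(2) a(2)[OF that] by simp
    show "z = y \<or> R z y \<or> (\<exists>u\<in>Y. R z u \<and> R u y)" if z: "z \<in> Y" for z
    proof (rule ccontr)
      assume no: "\<not> ?thesis"
      have "u \<in> N Y y" if u: "u \<in> N Y z" for u
      proof -
        have "R z u" "u \<in> Y" using u total[of u z] z by (auto simp: N_def)
        with no show ?thesis by (auto simp: N_def)
      qed
      moreover have "z \<in> N Y y" "z \<notin> N Y z" using no z by (auto simp: N_def)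
      ultimately have sub: "N Y z \<subset> N Y y" by blast
      then have "sum w (N Y z) \<le> sum w (N Y a)"
        using sum_mono2[OF finN, of "N Y z" y w] y(2) by auto
      then have "card (N Y y) \<le> card (N Y z)" using y(3) z by blast
      with psubset_card_mono[OF finN sub] show False by simp
    qed
  qed
qed

text \<open>Averaging \<open>lower\<close> over \<open>y\<close> with weights \<open>w y\<close>
  bounds \<open>t\<close> by a sum over non-arcs in which each unordered pair counts at most once.
  The missing diagonal is estimated by Cauchy-Schwarz, which yields the factor
  \<open>card Y - 1\<close>.\<close>

lemma weighted_nonneighbour_average:
  fixes R :: "'a \<Rightarrow> 'a \<Rightarrow> bool" and w :: "'a \<Rightarrow> nat"
  assumes fin: "finite Y"
    and total: "\<And>u v. u \<in> Y \<Longrightarrow> v \<in> Y \<Longrightarrow> u \<noteq> v \<Longrightarrow> R u v \<or> R v u"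
    and lower: "\<And>y. y \<in> Y \<Longrightarrow> t \<le> sum w {z \<in> Y. z \<noteq> y \<and> \<not> R z y}"
    and "y \<in> Y"
  shows "2 * real t * card Y \<le> real (card Y - 1) * sum w Y"
proof (cases "sum w Y = 0")
  \<comment> \<open>The averaging ends by cancelling the total weight, so total weight zero, which
    forces \<open>t = 0\<close>, is treated apart.\<close>
  case True
  then have "sum w {z \<in> Y. z \<noteq> y \<and> \<not> R z y} = 0"
    using fin by simp
  with lower[OF \<open>y \<in> Y\<close>] show ?thesis by (simp add: sum_nonneg)
next
  case False
  define e where "e y z = (if z \<noteq> y \<and> \<not> R z y then 1 else 0 :: real)" for y z
  define f where "f z = real (w z)" for z
  define W where "W = sum f Y"
  have W: "W = real (sum w Y)" by (simp add: W_def f_def)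
  have Wpos: "W > 0" using False unfolding W by linarith
  have t: "real t \<le> (\<Sum>z\<in>Y. e y z * f z)" if "y \<in> Y" for y
  proof -
    have "real t \<le> real (sum w {z \<in> Y. z \<noteq> y \<and> \<not> R z y})"
      using lower[OF that] by linarith
    also have "\<dots> = (\<Sum>z\<in>Y. if z \<noteq> y \<and> \<not> R z y then f z else 0)"
      unfolding f_def of_nat_sum using fin by (intro sum.inter_filter)
    also have "\<dots> = (\<Sum>z\<in>Y. e y z * f z)"
      by (intro sum.cong) (auto simp: e_def)
    finally show ?thesis .
  qed
  let ?S = "\<Sum>y\<in>Y. \<Sum>z\<in>Y. f y * f z * e y z"
  have "real t * W = (\<Sum>y\<in>Y. f y * real t)"
    by (simp add: W_def sum_distrib_left mult.commute)
  also have "\<dots> \<le> (\<Sum>y\<in>Y. f y * (\<Sum>z\<in>Y. e y z * f z))"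
    by (intro sum_mono mult_left_mono t) (simp_all add: f_def)
  also have "\<dots> = ?S"
    by (simp add: sum_distrib_left mult_ac)
  finally have tW: "real t * W \<le> ?S" .
  have "2 * ?S = ?S + (\<Sum>y\<in>Y. \<Sum>z\<in>Y. f z * f y * e z y)"
    by (subst (3) sum.swap) simp
  also have "\<dots> = (\<Sum>y\<in>Y. \<Sum>z\<in>Y. f y * f z * (e y z + e z y))"
    by (simp add: sum.distrib[symmetric] algebra_simps)
  \<comment> \<open>For distinct vertices totality keeps \<open>e y z\<close> and
    \<open>e z y\<close> from both being 1; on the diagonal both are 0, and the subtracted square
    matches this.\<close>
  also have "\<dots> \<le> (\<Sum>y\<in>Y. \<Sum>z\<in>Y. f y * f z - (if z = y then (f y)\<^sup>2 else 0))"
  proof (intro sum_mono)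
    fix y z assume "y \<in> Y" "z \<in> Y"
    show "f y * f z * (e y z + e z y) \<le> f y * f z - (if z = y then (f y)\<^sup>2 else 0)"
      using total[OF \<open>y \<in> Y\<close> \<open>z \<in> Y\<close>]
      by (auto simp: e_def f_def power2_eq_square)
  qed
  also have "\<dots> = W\<^sup>2 - (\<Sum>y\<in>Y. (f y)\<^sup>2)"
    using fin by (simp add: sum_subtractf sum_product W_def power2_eq_square)
  finally have S: "2 * ?S \<le> W\<^sup>2 - (\<Sum>y\<in>Y. (f y)\<^sup>2)" .
  have "W\<^sup>2 \<le> card Y * (\<Sum>y\<in>Y. (f y)\<^sup>2)"
  proof -
    have "W\<^sup>2 \<le> (\<Sum>y\<in>Y. (f y)\<^sup>2) * card Y"
      unfolding W_def by (rule sum_squared_le_sum_of_squares)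
    then show ?thesis by (simp add: mult.commute)
  qed
  moreover have "card Y * (2 * (real t * W)) \<le> card Y * (W\<^sup>2 - (\<Sum>y\<in>Y. (f y)\<^sup>2))"
    using tW S by (intro mult_left_mono) auto
  moreover have "card Y \<ge> 1"
    using fin \<open>y \<in> Y\<close> by (auto simp: Suc_le_eq card_gt_0_iff)
  ultimately have "W * (2 * real t * card Y) \<le> W * (real (card Y - 1) * W)"
    by (simp add: algebra_simps power2_eq_square of_nat_diff)
  then show ?thesis using Wpos by (simp add: W)
qed

section \<open>Small quasi-kernels in one-way split digraphs\<close>

text \<open>An \<open>apath\<close> may not repeat a vertex. The ends differ since only one of them
  is in \<open>Q\<close>, and without loops the middle vertex differs from both, so walks of two
  arcs suffice.\<close>

lemma quasi_kernel_iff: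
  assumes "digraph D"
  shows "quasi_kernel D Q \<longleftrightarrow> independent_set D Q \<and>
    (\<forall>v\<in>verts D - Q. \<exists>q\<in>Q. v \<rightarrow>\<^bsub>D\<^esub> q \<or> (\<exists>u. v \<rightarrow>\<^bsub>D\<^esub> u \<and> u \<rightarrow>\<^bsub>D\<^esub> q))"
proof -
  interpret digraph D by fact
  have path_iff: "(\<exists>p. apath v p q \<and> length p \<in> {1, 2}) \<longleftrightarrow> v \<rightarrow>\<^bsub>D\<^esub> q \<or> (\<exists>u. v \<rightarrow>\<^bsub>D\<^esub> u \<and> u \<rightarrow>\<^bsub>D\<^esub> q)" (is "?L \<longleftrightarrow> ?R")
    if "v \<noteq> q" for v q
  proof
    assume ?L
    then obtain p where "apath v p q" "length p = 1 \<or> length p = 2" by auto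
    then show ?R
      by (fastforce simp: length_Suc_conv numeral_2_eq_2 apath_simps arcs_ends_conv)
  next
    assume ?R
    then consider e where "e \<in> arcs D" "tail D e = v" "head D e = q"
      | e e' where "e \<in> arcs D" "tail D e = v" "e' \<in> arcs D" "tail D e' = head D e" "head D e' = q"
      by (auto simp: arcs_ends_conv)
    then show ?L
    proof cases
      case (1 e)
      then have "apath v [e] q" using that by (auto simp: apath_simps)
      then show ?thesis by (metis One_nat_def insertI1 length_Cons list.size(3))
    next
      case (2 e e')
      then have "apath v [e, e'] q"
        using that no_loops[of e] no_loops[of e'] by (auto simp: apath_simps)
      then show ?thesis by (intro exI[of _ "[e, e']"]) simp
    qed
  qed
  show ?thesis
    unfolding quasi_kernel_def by (intro conj_cong refl ball_cong bex_cong path_iff) auto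
qed

lemma card_vimage_eq_sum_fibres:
  assumes "finite X" "finite S"
  shows "card {x \<in> X. f x \<in> S} = (\<Sum>z\<in>S. card {x \<in> X. f x = z})"
proof -
  have "{x \<in> X. f x \<in> S} = (\<Union>z\<in>S. {x \<in> X. f x = z})" by auto
  then show ?thesis using assms by (subst card_UN_disjoint[symmetric]) auto
qed

text \<open>Here \<open>m\<close> stands for the order of the semicomplete part, and the summand 1
  for its vertex in the quasi-kernel. The bound amounts to \<open>(m - sqrt n)^2 \<ge> 0\<close>,
  tight at \<open>n = m^2\<close>.\<close>

lemma small_quasi_kernel_bound:
  fixes t m n :: real
  assumes "m > 0" "n \<ge> 0" and t: "2 * t * m \<le> (m - 1) * (n - m)"
  shows "1 + t \<le> (n + 3) / 2 - sqrt n"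
proof -
  have "0 \<le> (m - sqrt n)\<^sup>2" by simp
  then have "2 * sqrt n * m \<le> m\<^sup>2 + n"
    using \<open>n \<ge> 0\<close> by (simp add: power2_diff mult_ac)
  with t have "m * (2 * t) \<le> m * (n + 1 - 2 * sqrt n)"
    by (simp add: algebra_simps power2_eq_square)
  then have "2 * t \<le> n + 1 - 2 * sqrt n" using \<open>m > 0\<close> by simp
  then show ?thesis by (simp add: field_simps)
qed

lemma one_way_split_small_quasi_kernel:
  assumes "digraph D" and split: "one_way_split D" and nosink: "\<And>v. \<not> sink D v"
  shows "\<exists>Q. quasi_kernel D Q \<and>
    real (card Q) \<le> (real (card (verts D)) + 3) / 2 - sqrt (real (card (verts D)))"
proof (cases "verts D = {}")
  case True
  \<comment> \<open>The choice of \<open>y\<close> below needs a nonempty \<open>Y\<close>; for the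
    empty digraph the bound reads 0 \<le> 3/2.\<close>
  have "quasi_kernel D {}"
    by (simp add: quasi_kernel_def independent_set_def True)
  then show ?thesis
    by (intro exI[of _ "{}"]) (simp add: True)
next
  case False
  interpret digraph D by fact
  obtain X Y where V: "verts D = X \<union> Y" and disj: "X \<inter> Y = {}" and indep: "independent_set D X"
    and semi: "semicomplete (D \<restriction> Y)" and YX: "\<And>x y. x \<in> X \<Longrightarrow> y \<in> Y \<Longrightarrow> \<not> y \<rightarrow>\<^bsub>D\<^esub> x"
    using split unfolding one_way_split_def by blast
  have fin: "finite X" "finite Y" using finite_verts V by auto
  have "\<exists>y\<in>Y. x \<rightarrow>\<^bsub>D\<^esub> y" if "x \<in> X" for x
    using nosink[of x] indep that V unfolding sink_def independent_set_def by blast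
  then obtain f where f: "\<And>x. x \<in> X \<Longrightarrow> f x \<in> Y" "\<And>x. x \<in> X \<Longrightarrow> x \<rightarrow>\<^bsub>D\<^esub> f x"
    by metis
  have ne: "Y \<noteq> {}" using False V f(1) by auto
  have total: "u \<rightarrow>\<^bsub>D\<^esub> v \<or> v \<rightarrow>\<^bsub>D\<^esub> u" if "u \<in> Y" "v \<in> Y" "u \<noteq> v" for u v
    using semi that dominates_induce_subgraphD[where G = D and S = Y] unfolding semicomplete_def
    by (metis induce_subgraph_verts)
  \<comment> \<open>Charging each vertex of \<open>X\<close> to a single out-neighbour makes the
    weights add up to \<open>card X\<close>.\<close>
  define w where "w z = card {x \<in> X. f x = z}" for z
  define N where "N y = {z \<in> Y. z \<noteq> y \<and> \<not> z \<rightarrow>\<^bsub>D\<^esub> y}" for y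
  obtain y where y: "y \<in> Y" and king: "\<And>z. z \<in> Y \<Longrightarrow> z = y \<or> z \<rightarrow>\<^bsub>D\<^esub> y \<or> (\<exists>u\<in>Y. z \<rightarrow>\<^bsub>D\<^esub> u \<and> u \<rightarrow>\<^bsub>D\<^esub> y)"
    and min: "\<And>z. z \<in> Y \<Longrightarrow> sum w (N y) \<le> sum w (N z)"
    using king_of_minimal_nonneighbour_weight[where R = "\<lambda>u v. u \<rightarrow>\<^bsub>D\<^esub> v" and w = w, OF fin(2) ne total]
    unfolding N_def by blast
  define U where "U = {x \<in> X. \<not> x \<rightarrow>\<^bsub>D\<^esub> y \<and> \<not> (\<exists>u. x \<rightarrow>\<^bsub>D\<^esub> u \<and> u \<rightarrow>\<^bsub>D\<^esub> y)}"
  have "independent_set D (insert y U)"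
    using V y indep YX adj_not_same unfolding independent_set_def U_def by blast
  then have qk: "quasi_kernel D (insert y U)"
    unfolding quasi_kernel_iff[OF \<open>digraph D\<close>] using V king U_def by blast
  \<comment> \<open>If \<open>f x\<close> were \<open>y\<close> or had an arc to \<open>y\<close>,
    then \<open>x\<close> would reach \<open>y\<close> within two steps through
    \<open>f x\<close>.\<close>
  have "card U \<le> card {x \<in> X. f x \<in> N y}"
    using f fin by (intro card_mono) (auto simp: U_def N_def)
  also have "\<dots> = sum w (N y)"
    unfolding w_def using fin by (intro card_vimage_eq_sum_fibres) (auto simp: N_def)
  finally have U: "card U \<le> sum w (N y)" .
  have "sum w Y = card {x \<in> X. f x \<in> Y}"
    unfolding w_def using fin by (intro card_vimage_eq_sum_fibres[symmetric])
  also have "{x \<in> X. f x \<in> Y} = X" using f(1) by auto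
  finally have W: "sum w Y = card X" .
  have m: "card Y > 0" using fin ne by (simp add: card_gt_0_iff)
  have "2 * real (sum w (N y)) * card Y \<le> real (card Y - 1) * card X"
    unfolding W[symmetric]
    using weighted_nonneighbour_average[where R = "\<lambda>u v. u \<rightarrow>\<^bsub>D\<^esub> v" and w = w, OF fin(2) total _ y] min
    unfolding N_def by blast
  also have "real (card X) = real (card (verts D)) - card Y"
    using V disj fin by (simp add: card_Un_disjoint)
  finally have "1 + real (sum w (N y)) \<le> (real (card (verts D)) + 3) / 2 - sqrt (real (card (verts D)))"
    using m by (intro small_quasi_kernel_bound[of "card Y"]) (auto simp: of_nat_diff)
  moreover have "card (insert y U) \<le> 1 + sum w (N y)"
    using U card_insert_le_m1[of "Suc (card U)" U y] fin by (simp add: card_insert_if U_def)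
  ultimately show ?thesis
    using qk by (intro exI[of _ "insert y U"]) linarith
qed

section \<open>The extremal digraphs\<close>

text \<open>\<open>{..<m}\<close> plays the role of \<open>Y\<close> and carries the rotational tournament; \<open>{m..<m\<^sup>2}\<close> is \<open>X\<close>.\<close>

definition extremal_arcs :: "nat \<Rightarrow> (nat \<times> nat) set" where
  "extremal_arcs k = (let m = 2 * k + 1 in
     {(u, (u + i) mod m) | u i. u < m \<and> 1 \<le> i \<and> i \<le> k} \<union> {(x, x mod m) | x. m \<le> x \<and> x < m\<^sup>2})"

definition extremal_digraph :: "nat \<Rightarrow> (nat, nat \<times> nat) pre_digraph" where
  "extremal_digraph k =
     \<lparr>verts = {..<(2 * k + 1)\<^sup>2}, arcs = extremal_arcs k, tail = fst, head = snd\<rparr>"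

lemma extremal_digraph_dominates [simp]:
  "u \<rightarrow>\<^bsub>extremal_digraph k\<^esub> v \<longleftrightarrow> (u, v) \<in> extremal_arcs k"
  by (simp add: extremal_digraph_def arcs_ends_conv)

lemma verts_extremal_digraph [simp]: "verts (extremal_digraph k) = {..<(2 * k + 1)\<^sup>2}"
  by (simp add: extremal_digraph_def)

lemma extremal_arcs_iff:
  assumes "m = 2 * k + 1"
  shows "(u, v) \<in> extremal_arcs k \<longleftrightarrow>
    u < m \<and> (\<exists>i. 1 \<le> i \<and> i \<le> k \<and> v = (u + i) mod m) \<or> m \<le> u \<and> u < m\<^sup>2 \<and> v = u mod m"
  using assms by (auto simp: extremal_arcs_def Let_def)

lemma extremal_arcs_head_less: "(u, v) \<in> extremal_arcs k \<Longrightarrow> v < 2 * k + 1"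
  by (auto simp: extremal_arcs_iff)

lemma mod_add_eq_self_iff:
  fixes u i m :: nat
  assumes "u < m"
  shows "(u + i) mod m = u \<longleftrightarrow> m dvd i"
  using mod_eq_dvd_iff_nat[of u "u + i" m] assms by simp

text \<open>Heads lie below \<open>m\<close>, so both arcs are rotations by some \<open>i\<close>
  and \<open>j\<close> in 1..k; returning to \<open>u\<close> makes \<open>m\<close> divide
  \<open>i + j\<close>, yet 0 < i + j \<le> 2k < m. The case \<open>u = v\<close> excludes
  loops.\<close>

lemma extremal_arcs_not_sym:
  assumes "(u, v) \<in> extremal_arcs k" "(v, u) \<in> extremal_arcs k"
  shows False
proof -
  define m where "m = 2 * k + 1"
  note iff = extremal_arcs_iff[OF m_def]
  have "u < m" "v < m" using assms extremal_arcs_head_less by (auto simp: m_def)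
  then obtain i j where ij: "1 \<le> i" "i \<le> k" "v = (u + i) mod m" "1 \<le> j" "j \<le> k" "u = (v + j) mod m"
    using assms unfolding iff by auto
  then have "(u + (i + j)) mod m = u" by (metis add.assoc mod_add_left_eq)
  then have "m dvd i + j" using mod_add_eq_self_iff \<open>u < m\<close> by blast
  then show False using ij(1,2,4,5) by (auto simp: m_def dest: dvd_imp_le)
qed

text \<open>Around the cycle, the distances from \<open>u\<close> to \<open>v\<close> and back add
  up to 2k + 1, so one of them is at most \<open>k\<close>.\<close>

lemma extremal_arcs_total:
  assumes "u < v" "v < 2 * k + 1"
  shows "(u, v) \<in> extremal_arcs k \<or> (v, u) \<in> extremal_arcs k"
proof -
  define m where "m = 2 * k + 1"
  note iff = extremal_arcs_iff[OF m_def]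
  show ?thesis
  proof (cases "v - u \<le> k")
    case True
    then have "(u, v) \<in> extremal_arcs k"
      unfolding iff using assms by (auto simp: m_def intro!: exI[of _ "v - u"])
    then show ?thesis ..
  next
    case False
    have "v + (m - (v - u)) = u + m" using assms by (auto simp: m_def)
    then have "u = (v + (m - (v - u))) mod m" using assms by (metis m_def mod_add_self2 mod_less order.strict_trans)
    moreover have "1 \<le> m - (v - u)" "m - (v - u) \<le> k" using False assms by (auto simp: m_def)
    ultimately have "(v, u) \<in> extremal_arcs k"
      unfolding iff using assms by (auto simp: m_def)
    then show ?thesis ..
  qed
qed

lemma extremal_arcs_tail_less: "(u, v) \<in> extremal_arcs k \<Longrightarrow> u < (2 * k + 1)\<^sup>2"
  by (force simp: extremal_arcs_iff[OF refl] power2_eq_square intro: less_le_trans)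

lemma digraph_extremal_digraph: "digraph (extremal_digraph k)"
proof -
  have sub: "extremal_arcs k \<subseteq> {..<(2 * k + 1)\<^sup>2} \<times> {..<(2 * k + 1)\<^sup>2}"
    using extremal_arcs_head_less[of _ _ k] extremal_arcs_tail_less[of _ _ k]
    by (force simp: power2_eq_square)
  have "finite (extremal_arcs k)"
    using finite_subset[OF sub] by simp
  then show ?thesis
    using sub extremal_arcs_not_sym
    by unfold_locales (auto simp: extremal_digraph_def arc_to_ends_def)
qed

lemma one_way_split_extremal_digraph: "one_way_split (extremal_digraph k)"
proof -
  let ?D = "extremal_digraph k" and ?m = "2 * k + 1"
  have "semicomplete (?D \<restriction> {..<?m})"
    unfolding semicomplete_def
  proof (intro ballI impI)
    fix u v assume uv: "u \<in> verts (?D \<restriction> {..<?m})" "v \<in> verts (?D \<restriction> {..<?m})" "u \<noteq> v"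
    then have "(u, v) \<in> extremal_arcs k \<or> (v, u) \<in> extremal_arcs k"
      using extremal_arcs_total[of u v k] extremal_arcs_total[of v u k] by fastforce
    with uv show "u \<rightarrow>\<^bsub>?D \<restriction> {..<?m}\<^esub> v \<or> v \<rightarrow>\<^bsub>?D \<restriction> {..<?m}\<^esub> u"
      using wf_digraph.dominates_induce_ss[of ?D]
      by (force simp: extremal_digraph_def arcs_ends_conv)
  qed
  moreover have "verts ?D = {?m..<?m\<^sup>2} \<union> {..<?m}" by (auto simp: power2_eq_square)
  moreover have "independent_set ?D {?m..<?m\<^sup>2}"
    unfolding independent_set_def by (auto dest: extremal_arcs_head_less)
  moreover have "\<forall>x\<in>{?m..<?m\<^sup>2}. \<forall>y\<in>{..<?m}. \<not> y \<rightarrow>\<^bsub>?D\<^esub> x"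
    by (auto dest: extremal_arcs_head_less)
  moreover have "{?m..<?m\<^sup>2} \<inter> {..<?m} = {}" by auto
  ultimately show ?thesis unfolding one_way_split_def by blast
qed

lemma extremal_digraph_no_sink:
  assumes "k \<ge> 1"
  shows "\<not> sink (extremal_digraph k) v"
proof
  assume "sink (extremal_digraph k) v"
  then have v: "v < (2 * k + 1)\<^sup>2" and no: "\<And>w. (v, w) \<notin> extremal_arcs k"
    using digraph_extremal_digraph[of k] extremal_arcs_head_less[of v _ k]
    by (force simp: sink_def power2_eq_square)+
  show False
    \<comment> \<open>A tournament vertex has its rotation by 1, available as
      \<open>k \<ge> 1\<close>; any other vertex has the arc to its residue.\<close>
    using no[of "(v + 1) mod (2 * k + 1)"] no[of "v mod (2 * k + 1)"] v assms
    by (auto simp: extremal_arcs_iff)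
qed

text \<open>\<open>Q\<close> contains exactly one tournament vertex \<open>y\<close>. A private
  in-neighbour of an out-neighbour \<open>z\<close> of \<open>y\<close> can leave only through
  \<open>z\<close>, which has no arc back to \<open>y\<close>, so it must lie in \<open>Q\<close>.
  There are \<open>k\<close> such \<open>z\<close> with 2k private vertices each.\<close>

lemma extremal_digraph_quasi_kernel_ge:
  assumes qk: "quasi_kernel (extremal_digraph k) Q"
  shows "1 + 2 * k\<^sup>2 \<le> card Q"
proof -
  define m where "m = 2 * k + 1"
  note iff = extremal_arcs_iff[OF m_def]
  have m: "m > 0" "m \<le> m\<^sup>2" by (auto simp: m_def power2_eq_square)
  have sub: "Q \<subseteq> {..<m\<^sup>2}" and indep: "\<And>u v. u \<in> Q \<Longrightarrow> v \<in> Q \<Longrightarrow> (u, v) \<notin> extremal_arcs k"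
    and reach: "\<And>v. v < m\<^sup>2 \<Longrightarrow> v \<notin> Q \<Longrightarrow>
      \<exists>q\<in>Q. (v, q) \<in> extremal_arcs k \<or> (\<exists>u. (v, u) \<in> extremal_arcs k \<and> (u, q) \<in> extremal_arcs k)"
    using qk unfolding quasi_kernel_iff[OF digraph_extremal_digraph] independent_set_def
    by (auto simp: m_def)
  \<comment> \<open>Vertex 0 is in the tournament, and so is the head of every arc; either 0 is in
    \<open>Q\<close> or it reaches a suitable vertex.\<close>
  have "\<exists>y\<in>Q. y < m"
    using reach[of 0] extremal_arcs_head_less[of _ _ k] m unfolding m_def by fastforce
  then obtain y where y: "y \<in> Q" "y < m" by blast
  have unique: "z = y" if "z \<in> Q" "z < m" for z
    using extremal_arcs_total[of y z k] extremal_arcs_total[of z y k] indep that y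
    unfolding m_def by (metis nat_neq_iff)
  \<comment> \<open>For \<open>j\<close> from 1 to m - 1 these are the vertices outside the
    tournament with residue \<open>(y + i) mod m\<close>; \<open>j = 0\<close> would give the
    tournament vertex itself.\<close>
  define g where "g = (\<lambda>(i, j). (y + i) mod m + j * m)"
  have "g (i, j) \<in> Q - {y}" if "i \<in> {1..k}" "j \<in> {1..<m}" for i j
  proof -
    let ?x = "g (i, j)" and ?z = "(y + i) mod m"
    have x: "?x mod m = ?z" by (simp add: g_def)
    have arc: "(y, ?z) \<in> extremal_arcs k" unfolding iff using y that by auto
    have "?x < m + j * m" using m by (simp add: g_def)
    also have "\<dots> = (j + 1) * m" by simp
    also have "\<dots> \<le> m * m" using that by (intro mult_right_mono) auto
    finally have lt: "?x < m\<^sup>2" by (simp add: power2_eq_square)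
    have "m \<le> j * m" using that by simp
    then have ge: "m \<le> ?x" by (auto simp: g_def intro: trans_le_add2)
    have out: "u = ?z" if "(?x, u) \<in> extremal_arcs k" for u
      using that ge unfolding iff x by auto
    have "?x \<in> Q"
    proof (rule ccontr)
      assume "?x \<notin> Q"
      from reach[OF lt this] obtain q where q: "q \<in> Q"
        and "(?x, q) \<in> extremal_arcs k \<or> (\<exists>u. (?x, u) \<in> extremal_arcs k \<and> (u, q) \<in> extremal_arcs k)"
        by blast
      then have "q = ?z \<or> (?z, q) \<in> extremal_arcs k" using out by metis
      moreover from this have "q < m" using extremal_arcs_head_less m unfolding m_def by auto
      then have "q = y" using unique q by simp
      \<comment> \<open>If \<open>?z\<close> is \<open>y\<close>, then \<open>arc\<close> is a loop
        at \<open>y\<close>; otherwise the arc from \<open>?z\<close> to \<open>y\<close> reverses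
        \<open>arc\<close>.\<close>
      ultimately show False using arc indep[OF y(1) q] extremal_arcs_not_sym by metis
    qed
    then show ?thesis using ge y by auto
  qed
  then have img: "g ` ({1..k} \<times> {1..<m}) \<subseteq> Q - {y}"
    unfolding image_subset_iff by blast
  have "inj_on g ({1..k} \<times> {1..<m})"
  proof (rule inj_onI, clarify)
    fix i j i' j' assume ij: "i \<in> {1..k}" "i' \<in> {1..k}" and eq: "g (i, j) = g (i', j')"
    \<comment> \<open>The quotient recovers \<open>j\<close>; the residue recovers \<open>i\<close>
      because \<open>i \<le> k < m\<close>.\<close>
    have "g (i, j) mod m = g (i', j') mod m" "g (i, j) div m = g (i', j') div m" using eq by auto
    then have e: "(y + i) mod m = (y + i') mod m" and "j = j'" using m by (auto simp: g_def)
    have "i mod m = i' mod m"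
      using e unfolding nat_mod_eq_iff by (simp add: add.assoc)
    then show "i = i' \<and> j = j'" using ij \<open>j = j'\<close> by (simp add: m_def)
  qed
  then have "card (g ` ({1..k} \<times> {1..<m})) = k * (m - 1)"
    by (simp add: card_image)
  moreover have finQ: "finite Q" using sub finite_subset by blast
  ultimately have "k * (m - 1) \<le> card (Q - {y})"
    using card_mono[OF _ img] by simp
  moreover have "card Q = Suc (card (Q - {y}))"
    by (rule card_Suc_Diff1[OF finQ y(1), symmetric])
  ultimately show ?thesis by (simp add: m_def power2_eq_square)
qed

text \<open>No minimum quasi-kernel is written down: at this \<open>n\<close> the general upper
  bound equals 2k^2 + 1, which is also the lower bound.\<close>

lemma extremal_digraph_minimum_quasi_kernel:
  assumes "k \<ge> 1"
  defines "n \<equiv> (2 * k + 1)\<^sup>2"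
  shows "\<exists>Q. quasi_kernel (extremal_digraph k) Q \<and> real (card Q) = (real n + 3) / 2 - sqrt (real n) \<and>
    (\<forall>Q'. quasi_kernel (extremal_digraph k) Q' \<longrightarrow> card Q \<le> card Q')"
proof -
  have n: "(real n + 3) / 2 - sqrt (real n) = real (1 + 2 * k\<^sup>2)"
  proof -
    have "sqrt (real n) = 2 * real k + 1" by (simp add: n_def)
    then show ?thesis by (simp add: n_def power2_eq_square field_simps)
  qed
  have cn: "card (verts (extremal_digraph k)) = n" by (simp add: n_def)
  obtain Q where Q: "quasi_kernel (extremal_digraph k) Q" "real (card Q) \<le> real (1 + 2 * k\<^sup>2)"
    using one_way_split_small_quasi_kernel[OF digraph_extremal_digraph one_way_split_extremal_digraph
        extremal_digraph_no_sink[OF assms(1)]] unfolding cn n by blast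
  with extremal_digraph_quasi_kernel_ge have "card Q = 1 + 2 * k\<^sup>2"
    by (metis le_antisym of_nat_le_iff)
  with Q(1) extremal_digraph_quasi_kernel_ge show ?thesis unfolding n by metis
qed

theorem theorem6:
  shows "(\<forall>D :: ('a, 'b) pre_digraph.
            digraph D \<and> one_way_split D \<and> (\<forall>v. \<not> sink D v) \<longrightarrow>
            (\<exists>Q. quasi_kernel D Q \<and>
                 real (card Q) \<le> (real (card (verts D)) + 3) / 2 - sqrt (real (card (verts D)))))
       \<and> infinite {n :: nat. \<exists>D :: (nat, nat \<times> nat) pre_digraph.
            digraph D \<and> one_way_split D \<and> (\<forall>v. \<not> sink D v) \<and> card (verts D) = n \<and>
            (\<exists>Q. quasi_kernel D Q \<and>
                 real (card Q) = (real n + 3) / 2 - sqrt (real n) \<and>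
                 (\<forall>Q'. quasi_kernel D Q' \<longrightarrow> card Q \<le> card Q'))}"
    (is "?bound \<and> infinite ?sharp")
proof
  show ?bound using one_way_split_small_quasi_kernel by blast
  \<comment> \<open>For \<open>k = 0\<close> the digraph is a single vertex, hence a sink, so the
    family starts at 1.\<close>
  have "(2 * k + 1)\<^sup>2 \<in> ?sharp" if "k \<ge> 1" for k
    using digraph_extremal_digraph[of k] one_way_split_extremal_digraph[of k]
      extremal_digraph_no_sink[OF that] extremal_digraph_minimum_quasi_kernel[OF that]
    by (intro CollectI exI[of _ "extremal_digraph k"]) simp
  then have "(\<lambda>k. (2 * k + 1)\<^sup>2) ` {1..} \<subseteq> ?sharp" by auto
  moreover have "inj_on (\<lambda>k :: nat. (2 * k + 1)\<^sup>2) {1..}"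
    by (rule inj_onI) simp
  then have "infinite ((\<lambda>k :: nat. (2 * k + 1)\<^sup>2) ` {1..})"
    by (simp add: finite_image_iff infinite_Ici)
  ultimately show "infinite ?sharp" using finite_subset by blast
qed

end
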